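(* Let $(f_n)_{n \in \mathbb{N}}$ be a sequence of gauge-measurable functions from $\mathbb{R}^d$ to $\mathbb{R}^p$. If $(f_n)_{n \in \mathbb{N}}$ converges pointwise to the function $f : \mathbb{R}^d \to \mathbb{R}^p$, then $f$ is gauge-measurable.
   Context: A gauge $\gamma$ on $\mathbb{R}^d$ is a function mapping each point $x \in \mathbb{R}^d$ to an open set $\gamma(x) \subset \mathbb{R}^d$ such that $x \in \gamma(x)$. A rectangle in $\mathbb{R}^d$ is a set of the form $R = [a_1,b_1) \times \cdots \times [a_d,b_d)$ with real numbers $a_1<b_1, \ldots, a_d<b_d$; its volume is $\operatorname{vol}(R) = (b_1-a_1)\cdots(b_d-a_d)$. A finite family of rectangles is disjoint if the rectangles are pairwise disjoint. Gauge measurability: a function $f : \mathbb{R}^d \to \mathbb{R}^p$ is gauge-measurable whenever, for every $\epsilon>0$ and every $\eta>0$, there exists a gauge $\gamma$ on $\mathbb{R}^d$ such that, for every finite family of disjoint rectangles $(R_i)_{i\in\{1,\ldots,k\}}$ in $\mathbb{R}^d$ and finite families of points $(c_i)_{i\in\{1,\ldots,k\}}$ and $(c'_i)_{i\in\{1,\ldots,k\}}$ in $\mathbb{R}^d$ satisfying $|f(c_i)-f(c'_i)| \geq \eta$ and $R_i \subset \gamma(c_i)\cap\gamma(c'_i)$ for every $i\in\{1,\ldots,k\}$, one has $\sum_{i=1}^k \operatorname{vol}(R_i) \leq \epsilon$. *)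

theory Defs
  imports "HOL-Analysis.Analysis"
begin

definition rect :: "real ^ 'd \<Rightarrow> real ^ 'd \<Rightarrow> (real ^ 'd) set" where
  "rect a b = {x. \<forall>j. a $ j \<le> x $ j \<and> x $ j < b $ j}"

text \<open>The volume is a function of the endpoints. Under the side condition
  \<open>\<forall>j. a $ j < b $ j\<close>, imposed wherever it is used below, the set \<open>rect a b\<close>
  determines \<open>a\<close> and \<open>b\<close>, so this is the volume of the rectangle itself.\<close>

definition rect_vol :: "real ^ 'd \<Rightarrow> real ^ 'd \<Rightarrow> real" where
  "rect_vol a b = (\<Prod>j\<in>UNIV. b $ j - a $ j)"

definition gauge_measurable :: "(real ^ 'd \<Rightarrow> real ^ 'p) \<Rightarrow> bool" where
  "gauge_measurable f \<longleftrightarrow>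
    (\<forall>\<epsilon>>0. \<forall>\<eta>>0. \<exists>\<gamma>. gauge \<gamma> \<and>
      (\<forall>(k::nat) (a :: nat \<Rightarrow> real ^ 'd) (b :: nat \<Rightarrow> real ^ 'd)
         (c :: nat \<Rightarrow> real ^ 'd) (c' :: nat \<Rightarrow> real ^ 'd).
        (\<forall>i\<in>{1..k}. \<forall>j. a i $ j < b i $ j) \<longrightarrow>
        disjoint_family_on (\<lambda>i. rect (a i) (b i)) {1..k} \<longrightarrow>
        (\<forall>i\<in>{1..k}. norm (f (c i) - f (c' i)) \<ge> \<eta> \<and>
                     rect (a i) (b i) \<subseteq> \<gamma> (c i) \<inter> \<gamma> (c' i)) \<longrightarrow>
        (\<Sum>i\<in>{1..k}. rect_vol (a i) (b i)) \<le> \<epsilon>))"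

end

theory Submission
  imports Defs
begin

text \<open>Gauge measurability is equivalent to Lebesgue measurability, which is stable under
  pointwise limits.

  For the forward direction, let \<open>A\<close> and \<open>B\<close> be sets whose images under \<open>f\<close> are at distance
  at least \<open>\<eta>\<close>, and let \<open>U\<close>, \<open>V\<close> be the unions of the \<open>\<gamma> x\<close> over \<open>A\<close> and \<open>B\<close>. Every point of
  \<open>U \<inter> V\<close> has a neighbourhood \<open>\<gamma> x \<inter> \<gamma> y\<close> with \<open>x \<in> A\<close>, \<open>y \<in> B\<close>; covering \<open>U \<inter> V\<close> by
  nonoverlapping boxes inside these neighbourhoods bounds its measure by \<open>\<epsilon>\<close>. Letting
  \<open>\<epsilon> \<rightarrow> 0\<close>, the sets \<open>A\<close> and \<open>B\<close> are separated by Borel sets up to a null set, and applying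
  this to \<open>{f \<le> t}\<close> and \<open>{f \<ge> t + 1/n}\<close> componentwise shows that \<open>f\<close> is measurable.

  Conversely, partition the domain into countably many measurable sets \<open>E n\<close> on which \<open>f\<close>
  oscillates by less than \<open>\<eta>\<close>, and let \<open>\<gamma>\<close> be constant on \<open>E n\<close>, with value an open superset
  of \<open>E n\<close> of only slightly larger measure. As the \<open>E n\<close> are disjoint, two different such
  supersets intersect only in the small excess.\<close>

section \<open>Half-open rectangles: volume, disjointness and coverings\<close>

lemma rect_subset_cbox: "rect a b \<subseteq> cbox a b"
  and box_subset_rect: "box a b \<subseteq> rect a b"
  by (simp_all add: subset_iff rect_def mem_box_cart less_imp_le)

lemma rect_borel: "rect a b \<in> sets borel"
proof -
  have "rect a b = (\<Inter>j. {x. a $ j \<le> x $ j} \<inter> {x. x $ j < b $ j})"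
    by (auto simp: rect_def)
  also have "\<dots> \<in> sets borel"
    by (intro sets.countable_INT'' sets.Int borel_closed borel_open
        closed_halfspace_component_ge_cart open_halfspace_component_lt_cart) auto
  finally show ?thesis .
qed

lemma rect_lmeasurable: "rect a b \<in> lmeasurable"
  by (rule fmeasurableI2[OF lmeasurable_cbox rect_subset_cbox])
    (simp add: rect_borel)

text \<open>The rectangle lies between the open and the closed box with the same endpoints, and
  these have equal measure.\<close>

lemma measure_rect:
  assumes "\<And>j. a $ j < b $ j"
  shows "measure lebesgue (rect a b) = rect_vol a b"
proof -
  have "cbox a b \<noteq> {}"
    using assms by (auto simp: interval_ne_empty_cart intro: less_imp_le)
  then have vol: "measure lebesgue (cbox a b) = rect_vol a b"
    by (simp add: content_cbox_cart rect_vol_def)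
  have "measure lebesgue (box a b) = measure lebesgue (cbox a b)"
    by (simp add: measure_lborel_box_eq measure_lborel_cbox_eq)
  moreover have "measure lebesgue (box a b) \<le> measure lebesgue (rect a b)"
    by (rule measure_mono_fmeasurable[OF box_subset_rect _ rect_lmeasurable]) simp
  moreover have "measure lebesgue (rect a b) \<le> measure lebesgue (cbox a b)"
    by (rule measure_mono_fmeasurable[OF rect_subset_cbox fmeasurableD[OF rect_lmeasurable]]) simp
  ultimately show ?thesis using vol by simp
qed

text \<open>In each coordinate, moving a common point halfway to the smaller upper endpoint puts it
  in both open boxes. So the nonoverlapping closed boxes of a covering yield truly disjoint
  rectangles.\<close>

lemma disjoint_rect:
  assumes "box a b \<inter> box a' b' = {}"
  shows "rect a b \<inter> rect a' b' = {}"
proof (rule ccontr)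
  assume "rect a b \<inter> rect a' b' \<noteq> {}"
  then obtain x where x: "x \<in> rect a b" "x \<in> rect a' b'" by auto
  define y where "y = (\<chi> j. (x $ j + min (b $ j) (b' $ j)) / 2)"
  have "a $ j < y $ j \<and> y $ j < b $ j \<and> a' $ j < y $ j \<and> y $ j < b' $ j" for j
  proof -
    have "a $ j \<le> x $ j" "x $ j < b $ j" "a' $ j \<le> x $ j" "x $ j < b' $ j"
      using x by (auto simp: rect_def)
    then show ?thesis by (simp add: y_def min_def)
  qed
  then have "y \<in> box a b \<inter> box a' b'" by (simp add: mem_box_cart)
  with assms show False by simp
qed

text \<open>Passes from the finite rectangle sums of the gauge condition to Lebesgue measure:
  \<open>W\<close> is covered by countably many nonoverlapping boxes, each inside \<open>g\<close>
  of some point of \<open>W\<close>, and \<open>sums\<close> controls every finite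
  subfamily.\<close>

lemma emeasure_le_if_rect_sums_le:
  fixes W :: "(real ^ 'd) set"
  assumes W: "W \<in> sets lebesgue"
    and g: "\<And>x. x \<in> W \<Longrightarrow> open (g x) \<and> x \<in> g x"
    and sums: "\<And>(k::nat) a b c.
      \<lbrakk>\<forall>i\<in>{1..k}. \<forall>j. a i $ j < b i $ j;
       disjoint_family_on (\<lambda>i. rect (a i) (b i)) {1..k};
       \<forall>i\<in>{1..k}. c i \<in> W \<and> rect (a i) (b i) \<subseteq> g (c i)\<rbrakk>
      \<Longrightarrow> (\<Sum>i\<in>{1..k}. rect_vol (a i) (b i)) \<le> e"
  shows "emeasure lebesgue W \<le> ennreal e"
proof -
  \<comment> \<open>\<open>covering_lemma\<close> treats subsets of a bounded box, so
    \<open>W\<close> is exhausted by its intersections with growing cubes.\<close>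
  define B :: "nat \<Rightarrow> (real ^ 'd) set" where "B n = box (- real n *\<^sub>R One) (real n *\<^sub>R One)" for n
  have bounded_part: "emeasure lebesgue (W \<inter> B n) \<le> ennreal e" if "n > 0" for n
  proof -
    let ?l = "- real n *\<^sub>R One :: real ^ 'd" and ?u = "real n *\<^sub>R One :: real ^ 'd"
    have sub: "W \<inter> B n \<subseteq> cbox ?l ?u"
      unfolding B_def using box_subset_cbox by blast
    have ne: "box ?l ?u \<noteq> {}"
      using that by (simp add: box_ne_empty inner_Basis)
    \<comment> \<open>The value \<open>UNIV\<close> off \<open>W\<close> only makes the gauge total;
      the points chosen by the covering lie in \<open>W\<close>.\<close>
    have gauge: "gauge (\<lambda>x. if x \<in> W then g x else UNIV)"
      using g by (auto simp: gauge_def)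
    obtain D where D: "countable D"
        "\<And>K. K \<in> D \<Longrightarrow> interior K \<noteq> {} \<and> (\<exists>c d. K = cbox c d)"
        "pairwise (\<lambda>A B. interior A \<inter> interior B = {}) D"
        "\<And>K. K \<in> D \<Longrightarrow> \<exists>x \<in> (W \<inter> B n) \<inter> K. K \<subseteq> (if x \<in> W then g x else UNIV)"
        "W \<inter> B n \<subseteq> \<Union>D"
      by (rule covering_lemma[OF sub ne gauge]) blast
    obtain u v where uv: "\<And>K. K \<in> D \<Longrightarrow> K = cbox (u K) (v K)"
      using D(2) by metis
    obtain p where p: "\<And>K. K \<in> D \<Longrightarrow> p K \<in> W \<and> K \<subseteq> g (p K)"
      using D(4) by (metis IntD1)
    have int: "interior K = box (u K) (v K)" if "K \<in> D" for K
      using uv[OF that] by (metis interior_cbox)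
    have less: "u K $ j < v K $ j" if "K \<in> D" for K j
      using D(2)[OF that] int[OF that] by (simp add: interval_ne_empty_cart)
    have vol: "measure lebesgue K = rect_vol (u K) (v K)" if "K \<in> D" for K
    proof -
      have "cbox (u K) (v K) \<noteq> {}"
        using less[OF that] by (auto simp: interval_ne_empty_cart intro: less_imp_le)
      then show ?thesis
        using uv[OF that] by (metis content_cbox_cart measure_completion rect_vol_def
            borel_closed closed_cbox sets_lborel)
    qed
    have meas: "K \<in> lmeasurable" if "K \<in> D" for K
      using uv[OF that] by (metis lmeasurable_cbox)
    have fin: "measure lebesgue (\<Union>F) \<le> e" if F: "F \<subseteq> D" "finite F" for F
    proof -
      obtain h where h: "bij_betw h {1..card F} F"
        using ex_bij_betw_nat_finite_1[OF F(2)] by blast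
      have hD: "h i \<in> D" if "i \<in> {1..card F}" for i
        using bij_betwE[OF h] that F(1) by blast
      have "measure lebesgue (\<Union>F) \<le> (\<Sum>K\<in>F. measure lebesgue K)"
        using F meas by (intro measure_Union_le) auto
      also have "\<dots> = (\<Sum>K\<in>F. rect_vol (u K) (v K))"
        using F vol by (intro sum.cong) auto
      also have "\<dots> = (\<Sum>i\<in>{1..card F}. rect_vol (u (h i)) (v (h i)))"
        by (rule sum.reindex_bij_betw[OF h, symmetric])
      \<comment> \<open>Each closed box is replaced by the rectangle with the same endpoints, which
        has the same volume and still lies in \<open>g (p (h i))\<close>.\<close>
      also have "\<dots> \<le> e"
      proof (rule sums[where c="\<lambda>i. p (h i)"])
        show "\<forall>i\<in>{1..card F}. \<forall>j. u (h i) $ j < v (h i) $ j"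
          using less hD by blast
        show "disjoint_family_on (\<lambda>i. rect (u (h i)) (v (h i))) {1..card F}"
          unfolding disjoint_family_on_def
        proof (intro ballI impI disjoint_rect)
          fix i j assume ij: "i \<in> {1..card F}" "j \<in> {1..card F}" "i \<noteq> j"
          then have "h i \<noteq> h j"
            using bij_betw_imp_inj_on[OF h] by (simp add: inj_on_eq_iff)
          then have "interior (h i) \<inter> interior (h j) = {}"
            using D(3) hD[OF ij(1)] hD[OF ij(2)] unfolding pairwise_def by blast
          then show "box (u (h i)) (v (h i)) \<inter> box (u (h j)) (v (h j)) = {}"
            using int hD[OF ij(1)] hD[OF ij(2)] by simp
        qed
        show "\<forall>i\<in>{1..card F}. p (h i) \<in> W \<and> rect (u (h i)) (v (h i)) \<subseteq> g (p (h i))"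
        proof (intro ballI conjI)
          fix i assume i: "i \<in> {1..card F}"
          show "p (h i) \<in> W" using p[OF hD[OF i]] by simp
          show "rect (u (h i)) (v (h i)) \<subseteq> g (p (h i))"
            using rect_subset_cbox[of "u (h i)" "v (h i)"] uv[OF hD[OF i]] p[OF hD[OF i]] by blast
        qed
      qed
      finally show ?thesis .
    qed
    \<comment> \<open>A bound uniform over finite subfamilies passes to the countable union.\<close>
    have DU: "\<Union>D \<in> lmeasurable" "measure lebesgue (\<Union>D) \<le> e"
      using fmeasurable_Union_bound[OF D(1) meas fin] measure_Union_bound[OF D(1) meas fin]
      by auto
    have "emeasure lebesgue (W \<inter> B n) \<le> emeasure lebesgue (\<Union>D)"
      using D(5) DU(1) by (intro emeasure_mono) auto
    also have "\<dots> = ennreal (measure lebesgue (\<Union>D))"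
      using DU(1) by (rule emeasure_eq_measure2)
    also have "\<dots> \<le> ennreal e"
      using DU(2) by (rule ennreal_leI)
    finally show ?thesis .
  qed
  have "(\<Union>n. B n) = UNIV"
    unfolding B_def using UN_box_eq_UNIV by simp
  then have "W = (\<Union>n. W \<inter> B n)" by blast
  then have "emeasure lebesgue W = emeasure lebesgue (\<Union>n. W \<inter> B n)" by simp
  also have "\<dots> = (SUP n. emeasure lebesgue (W \<inter> B n))"
  proof (rule SUP_emeasure_incseq[symmetric])
    show "range (\<lambda>n. W \<inter> B n) \<subseteq> sets lebesgue"
      using W by (auto simp: B_def)
    have "B m \<subseteq> B n" if "m \<le> n" for m n
      unfolding B_def using that by (intro subset_box_imp) (auto simp: inner_Basis)
    then show "incseq (\<lambda>n. W \<inter> B n)"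
      unfolding incseq_def by blast
  qed
  also have "\<dots> \<le> ennreal e"
  proof (rule SUP_least)
    fix n
    show "emeasure lebesgue (W \<inter> B n) \<le> ennreal e"
      \<comment> \<open>For \<open>n = 0\<close> the cube is empty, which the covering argument
        excludes.\<close>
      using bounded_part[of n] by (cases "n = 0") (auto simp: B_def)
  qed
  finally show ?thesis .
qed

section \<open>Gauge measurability implies Lebesgue measurability\<close>

lemma gauge_measurable_separate_open:
  fixes f :: "real ^ 'd \<Rightarrow> real ^ 'p"
  assumes f: "gauge_measurable f" and "\<eta> > 0" "\<epsilon> > 0"
    and sep: "\<And>x y. x \<in> A \<Longrightarrow> y \<in> B \<Longrightarrow> norm (f x - f y) \<ge> \<eta>"
  obtains U V where "open U" "open V" "A \<subseteq> U" "B \<subseteq> V" "emeasure lebesgue (U \<inter> V) \<le> ennreal \<epsilon>"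
proof -
  obtain \<gamma> where \<gamma>: "gauge \<gamma>" and sums: "\<forall>(k::nat) a b c c'.
      (\<forall>i\<in>{1..k}. \<forall>j. a i $ j < b i $ j) \<longrightarrow>
      disjoint_family_on (\<lambda>i. rect (a i) (b i)) {1..k} \<longrightarrow>
      (\<forall>i\<in>{1..k}. norm (f (c i) - f (c' i)) \<ge> \<eta> \<and> rect (a i) (b i) \<subseteq> \<gamma> (c i) \<inter> \<gamma> (c' i)) \<longrightarrow>
      (\<Sum>i\<in>{1..k}. rect_vol (a i) (b i)) \<le> \<epsilon>"
    using f[unfolded gauge_measurable_def, THEN spec, THEN mp, OF \<open>\<epsilon> > 0\<close>,
        THEN spec, THEN mp, OF \<open>\<eta> > 0\<close>]
    by (elim exE conjE) (rule that)
  define U V where "U = (\<Union>x\<in>A. \<gamma> x)" and "V = (\<Union>x\<in>B. \<gamma> x)"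
  have op: "open U" "open V" and sub: "A \<subseteq> U" "B \<subseteq> V"
    using \<gamma> by (auto simp: U_def V_def gauge_def)
  have "\<forall>z\<in>U \<inter> V. \<exists>x y. x \<in> A \<and> y \<in> B \<and> z \<in> \<gamma> x \<inter> \<gamma> y"
    by (auto simp: U_def V_def)
  \<comment> \<open>One point \<open>z\<close> of the overlap now stands for a pair of tags
    \<open>p z\<close>, \<open>q z\<close> whose values under \<open>f\<close> are at least \<eta>
    apart.\<close>
  then obtain p q where pq: "\<And>z. z \<in> U \<inter> V \<Longrightarrow> p z \<in> A \<and> q z \<in> B \<and> z \<in> \<gamma> (p z) \<inter> \<gamma> (q z)"
    by metis
  have "emeasure lebesgue (U \<inter> V) \<le> ennreal \<epsilon>"
  proof (rule emeasure_le_if_rect_sums_le[where g="\<lambda>z. \<gamma> (p z) \<inter> \<gamma> (q z)"])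
    show "U \<inter> V \<in> sets lebesgue"
      using op by (simp add: borel_open open_Int)
    show "open (\<gamma> (p z) \<inter> \<gamma> (q z)) \<and> z \<in> \<gamma> (p z) \<inter> \<gamma> (q z)" if "z \<in> U \<inter> V" for z
      using pq[OF that] \<gamma> by (auto simp: gauge_def)
  next
    fix k :: nat and a b c
    assume 1: "\<forall>i\<in>{1..k}. \<forall>j. a i $ j < b i $ j"
      and 2: "disjoint_family_on (\<lambda>i. rect (a i) (b i)) {1..k}"
      and 3: "\<forall>i\<in>{1..k}. c i \<in> U \<inter> V \<and> rect (a i) (b i) \<subseteq> \<gamma> (p (c i)) \<inter> \<gamma> (q (c i))"
    show "(\<Sum>i\<in>{1..k}. rect_vol (a i) (b i)) \<le> \<epsilon>"
    proof (rule sums[THEN spec, THEN spec, THEN spec, THEN spec[of _ "\<lambda>i. p (c i)"],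
          THEN spec[of _ "\<lambda>i. q (c i)"], THEN mp, THEN mp, THEN mp, OF 1 2])
      show "\<forall>i\<in>{1..k}. norm (f (p (c i)) - f (q (c i))) \<ge> \<eta> \<and>
          rect (a i) (b i) \<subseteq> \<gamma> (p (c i)) \<inter> \<gamma> (q (c i))"
        using 3 pq sep by simp
    qed
  qed
  then show thesis using that op sub by blast
qed

text \<open>Intersecting the open separations for the bounds \<open>1 / Suc n\<close> leaves G-delta
  sets with null overlap. No measurability of \<open>A\<close> or \<open>B\<close> is assumed, so
  this can serve to prove it.\<close>

lemma gauge_measurable_separate_borel:
  fixes f :: "real ^ 'd \<Rightarrow> real ^ 'p"
  assumes f: "gauge_measurable f" and "\<eta> > 0"
    and sep: "\<And>x y. x \<in> A \<Longrightarrow> y \<in> B \<Longrightarrow> norm (f x - f y) \<ge> \<eta>"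
  obtains U V where "U \<in> sets borel" "V \<in> sets borel" "A \<subseteq> U" "B \<subseteq> V"
    "U \<inter> V \<in> null_sets lebesgue"
proof -
  have "\<exists>U V. open U \<and> open V \<and> A \<subseteq> U \<and> B \<subseteq> V \<and>
      emeasure lebesgue (U \<inter> V) \<le> ennreal (1 / real (Suc n))" for n
    by (rule gauge_measurable_separate_open[OF f \<open>\<eta> > 0\<close> _ sep, of "1 / real (Suc n)" A B])
      (simp, assumption, assumption, blast)
  then obtain U V where UV: "\<And>n. open (U n)" "\<And>n. open (V n)" "\<And>n. A \<subseteq> U n" "\<And>n. B \<subseteq> V n"
      "\<And>n. emeasure lebesgue (U n \<inter> V n) \<le> ennreal (1 / real (Suc n))"
    by metis
  let ?U = "\<Inter>n. U n" and ?V = "\<Inter>n. V n"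
  have borel: "?U \<in> sets borel" "?V \<in> sets borel"
    using UV by (auto intro!: sets.countable_INT'' borel_open)
  have le: "emeasure lebesgue (?U \<inter> ?V) \<le> ennreal (1 / real (Suc n))" for n
  proof -
    have "emeasure lebesgue (?U \<inter> ?V) \<le> emeasure lebesgue (U n \<inter> V n)"
      using UV(1,2)[of n] by (intro emeasure_mono) (auto simp: borel_open open_Int)
    then show ?thesis using UV(5) by (rule order_trans)
  qed
  have "(\<lambda>n. ennreal (1 / real (Suc n))) \<longlonglongrightarrow> ennreal 0"
    using LIMSEQ_inverse_real_of_nat by (intro tendsto_ennrealI) (simp add: inverse_eq_divide)
  then have "emeasure lebesgue (?U \<inter> ?V) \<le> ennreal 0"
    by (rule LIMSEQ_le_const) (use le in blast)
  then have "?U \<inter> ?V \<in> null_sets lebesgue"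
    using borel by (auto simp: null_sets_def)
  then show thesis
    using that[OF borel] UV by blast
qed

lemma gauge_measurable_imp_borel_measurable:
  fixes f :: "real ^ 'd \<Rightarrow> real ^ 'p"
  assumes f: "gauge_measurable f"
  shows "f \<in> borel_measurable lebesgue"
proof -
  have "{x. f x \<bullet> i \<le> t} \<in> sets lebesgue" if i: "i \<in> Basis" for i t
  proof -
    \<comment> \<open>Separation requires a positive gap, so the complement of \<open>?A\<close> is
      exhausted by the sets \<open>?B n\<close>.\<close>
    let ?A = "{x. f x \<bullet> i \<le> t}" and ?B = "\<lambda>n. {x. f x \<bullet> i \<ge> t + 1 / real (Suc n)}"
    have "\<exists>U V. U \<in> sets borel \<and> V \<in> sets borel \<and> ?A \<subseteq> U \<and> ?B n \<subseteq> V \<and>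
        U \<inter> V \<in> null_sets lebesgue" for n
    proof (rule gauge_measurable_separate_borel[OF f, of "1 / real (Suc n)" ?A "?B n"])
      fix x y assume "x \<in> ?A" "y \<in> ?B n"
      then have "1 / real (Suc n) \<le> \<bar>(f x - f y) \<bullet> i\<bar>"
        by (simp add: inner_diff_left)
      also have "\<dots> \<le> norm (f x - f y)"
        by (rule Basis_le_norm[OF i])
      finally show "norm (f x - f y) \<ge> 1 / real (Suc n)" .
    qed auto
    then obtain U V where UV: "\<And>n. U n \<in> sets borel" "\<And>n. V n \<in> sets borel" "\<And>n. ?A \<subseteq> U n"
        "\<And>n. ?B n \<subseteq> V n" "\<And>n. U n \<inter> V n \<in> null_sets lebesgue"
      by metis
    have "(\<Inter>n. U n) - ?A \<subseteq> (\<Union>n. U n \<inter> V n)"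
    proof
      fix x assume x: "x \<in> (\<Inter>n. U n) - ?A"
      then obtain n where "1 / real (Suc n) < f x \<bullet> i - t"
        using nat_approx_posE[of "f x \<bullet> i - t"] by auto
      then have "x \<in> ?B n" by simp
      then show "x \<in> (\<Union>n. U n \<inter> V n)" using UV(4) x by blast
    qed
    moreover have "(\<Union>n. U n \<inter> V n) \<in> null_sets lebesgue"
      using UV(5) by (intro null_sets_UN') auto
    \<comment> \<open>Completeness of Lebesgue measure enters here: \<open>?A\<close> differs from a
      Borel superset by a subset of a null set.\<close>
    ultimately have "(\<Inter>n. U n) - ?A \<in> null_sets lebesgue"
      by (rule null_sets_completion_subset)
    moreover have "(\<Inter>n. U n) \<in> sets lebesgue"
      using UV(1) by (intro sets.countable_INT'' sets_completionI_sets) auto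
    ultimately have "(\<Inter>n. U n) - ((\<Inter>n. U n) - ?A) \<in> sets lebesgue"
      by blast
    also have "(\<Inter>n. U n) - ((\<Inter>n. U n) - ?A) = ?A"
      using UV(3) by blast
    finally show ?thesis .
  qed
  then show ?thesis
    by (subst borel_measurable_euclidean_space)
      (auto simp: borel_measurable_iff_halfspace_le)
qed

section \<open>Lebesgue measurability implies gauge measurability\<close>

lemma borel_measurable_imp_gauge_measurable:
  fixes f :: "real ^ 'd \<Rightarrow> real ^ 'p"
  assumes f [measurable]: "f \<in> borel_measurable lebesgue"
  shows "gauge_measurable f"
  unfolding gauge_measurable_def
proof (intro allI impI)
  fix \<epsilon> \<eta> :: real assume "\<epsilon> > 0" "\<eta> > 0"
  obtain D :: "(real ^ 'p) set" where D: "countable D" "\<And>X. open X \<Longrightarrow> X \<noteq> {} \<Longrightarrow> \<exists>d\<in>D. d \<in> X"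
    by (rule countable_dense_setE) blast
  define d where "d = from_nat_into D"
  have near: "\<exists>n. dist y (d n) < \<eta> / 2" for y
  proof -
    obtain z where z: "z \<in> D" "z \<in> ball y (\<eta> / 2)"
      using D(2)[of "ball y (\<eta> / 2)"] \<open>\<eta> > 0\<close> by auto
    then obtain n where "d n = z"
      using from_nat_into_surj[OF D(1)] by (metis d_def)
    then show ?thesis using z by auto
  qed
  \<comment> \<open>Taking the least index makes the choice measurable and the sets
    \<open>E n\<close> disjoint; the radius \<eta>/2 keeps two values with the same index less than
    \<eta> apart.\<close>
  define N where "N x = (LEAST n. dist (f x) (d n) < \<eta> / 2)" for x
  have N: "dist (f x) (d (N x)) < \<eta> / 2" for x
    unfolding N_def by (rule LeastI_ex) (rule near)
  define E where "E n = {x. N x = n}" for n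
  have E: "E n \<in> sets lebesgue" for n
  proof -
    have "N \<in> measurable lebesgue (count_space UNIV)"
      unfolding N_def by measurable
    then have "N -` {n} \<inter> space lebesgue \<in> sets lebesgue"
      by (rule measurable_sets) simp
    then show ?thesis by (simp add: E_def vimage_def)
  qed
  \<comment> \<open>The allowed excesses sum to \<epsilon> over all \<open>n\<close>.\<close>
  have "\<exists>U. open U \<and> E n \<subseteq> U \<and> emeasure lebesgue (U - E n) \<le> ennreal (\<epsilon> * (1/2) ^ Suc n)" for n
  proof -
    have "0 < \<epsilon> * (1/2) ^ Suc n" using \<open>\<epsilon> > 0\<close> by simp
    then show ?thesis
      by (rule sets_lebesgue_outer_open[OF E]) (blast intro: less_imp_le)
  qed
  then obtain U where U: "\<And>n. open (U n)" "\<And>n. E n \<subseteq> U n"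
      "\<And>n. emeasure lebesgue (U n - E n) \<le> ennreal (\<epsilon> * (1/2) ^ Suc n)"
    by metis
  define Z where "Z = (\<Union>n. U n - E n)"
  have UE: "U n - E n \<in> sets lebesgue" for n
    using E U(1) by (intro sets.Diff) auto
  have Z: "Z \<in> sets lebesgue"
    using UE by (auto simp: Z_def)
  have "emeasure lebesgue Z \<le> (\<Sum>n. emeasure lebesgue (U n - E n))"
    unfolding Z_def using UE by (intro emeasure_subadditive_countably) auto
  also have "\<dots> \<le> (\<Sum>n. ennreal (\<epsilon> * (1/2) ^ Suc n))"
    using U(3) by (intro suminf_le) auto
  also have "\<dots> = ennreal (\<epsilon> * 1)"
    using \<open>\<epsilon> > 0\<close> by (intro suminf_ennreal_eq sums_mult power_half_series) auto
  finally have mZ: "emeasure lebesgue Z \<le> ennreal \<epsilon>" by simp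
  show "\<exists>\<gamma>. gauge \<gamma> \<and>
      (\<forall>(k::nat) a b c c'.
        (\<forall>i\<in>{1..k}. \<forall>j. a i $ j < b i $ j) \<longrightarrow>
        disjoint_family_on (\<lambda>i. rect (a i) (b i)) {1..k} \<longrightarrow>
        (\<forall>i\<in>{1..k}. norm (f (c i) - f (c' i)) \<ge> \<eta> \<and> rect (a i) (b i) \<subseteq> \<gamma> (c i) \<inter> \<gamma> (c' i)) \<longrightarrow>
        (\<Sum>i\<in>{1..k}. rect_vol (a i) (b i)) \<le> \<epsilon>)"
  proof (intro exI[of _ "\<lambda>x. U (N x)"] conjI allI impI)
    show "gauge (\<lambda>x. U (N x))"
      using U by (auto simp: gauge_def E_def)
  next
    fix k :: nat and a b c c'
    assume less: "\<forall>i\<in>{1..k}. \<forall>j. a i $ j < b i $ j"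
      and disj: "disjoint_family_on (\<lambda>i. rect (a i) (b i)) {1..k}"
      and sep: "\<forall>i\<in>{1..k}. norm (f (c i) - f (c' i)) \<ge> \<eta> \<and>
        rect (a i) (b i) \<subseteq> U (N (c i)) \<inter> U (N (c' i))"
    have sub: "rect (a i) (b i) \<subseteq> Z" if i: "i \<in> {1..k}" for i
    proof -
      have "N (c i) \<noteq> N (c' i)"
      proof
        assume "N (c i) = N (c' i)"
        then have "dist (f (c i)) (f (c' i)) < \<eta>"
          using N[of "c i"] N[of "c' i"] by (metis dist_triangle_half_l)
        moreover have "\<eta> \<le> norm (f (c i) - f (c' i))" using sep i by blast
        ultimately show False by (simp add: dist_norm)
      qed
      \<comment> \<open>A point lies in only one \<open>E n\<close>, so a point of two different
        sets \<open>U m\<close>, \<open>U n\<close> is in the excess of at least one.\<close>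
      then have "U (N (c i)) \<inter> U (N (c' i)) \<subseteq> Z"
        unfolding Z_def E_def by (auto, metis)
      then show ?thesis using sep i by blast
    qed
    have "ennreal (\<Sum>i\<in>{1..k}. rect_vol (a i) (b i))
        = ennreal (\<Sum>i\<in>{1..k}. measure lebesgue (rect (a i) (b i)))"
      using less by (simp add: measure_rect)
    also have "\<dots> = (\<Sum>i\<in>{1..k}. emeasure lebesgue (rect (a i) (b i)))"
      by (subst sum_ennreal[symmetric]) (simp_all add: emeasure_eq_measure2[OF rect_lmeasurable])
    \<comment> \<open>Disjointness of the rectangles makes their total volume the measure of a
      single subset of \<open>Z\<close>.\<close>
    also have "\<dots> = emeasure lebesgue (\<Union>i\<in>{1..k}. rect (a i) (b i))"
      using disj by (intro sum_emeasure) (auto intro: fmeasurableD[OF rect_lmeasurable])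
    also have "\<dots> \<le> emeasure lebesgue Z"
      using sub Z by (intro emeasure_mono UN_least)
    also have "\<dots> \<le> ennreal \<epsilon>" by (rule mZ)
    finally show "(\<Sum>i\<in>{1..k}. rect_vol (a i) (b i)) \<le> \<epsilon>"
      using \<open>\<epsilon> > 0\<close> by (simp add: ennreal_le_iff)
  qed
qed

theorem proposition6p1:
  fixes fs :: "nat \<Rightarrow> real ^ 'd \<Rightarrow> real ^ 'p" and f :: "real ^ 'd \<Rightarrow> real ^ 'p"
  assumes "\<And>n. gauge_measurable (fs n)"
    and "\<And>x. (\<lambda>n. fs n x) \<longlonglongrightarrow> f x"
  shows "gauge_measurable f"
proof (rule borel_measurable_imp_gauge_measurable)
  show "f \<in> borel_measurable lebesgue"
    by (rule borel_measurable_LIMSEQ_metric[where f=fs])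
      (use assms gauge_measurable_imp_borel_measurable in blast)+
qed

end
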